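(* Let $b > 0$. Let $l, m \in \mathbb{Z}$ with $l < m$, let $a_j \in \mathbb{C}$ for $l \le j \le m$ with $a_l \neq 0$ and $a_m \neq 0$, and let $\lambda \in \mathbb{C}\setminus\{0\}$. Let $T : \mathbb{C}[x] \to \mathbb{C}[x]$ be the linear finite difference operator $$T(P)(x) = \sum_{j=l}^m a_j P(x - j\lambda),$$ and let $Q(t) = \sum_{j=l}^m a_j t^j$ be its generating rational function. Then $T$ preserves the set of complex polynomials having all zeros in the strip $\{z \in \mathbb{C} : |\operatorname{Im} z| \le b\}$ (that is, $T$ maps this set into itself) if and only if all of the following conditions are satisfied: 1. $\operatorname{Re} \lambda = 0$; 2. $l = -m$; 3. all roots of the generating function $Q$ belong to the unit circle $\{z : |z| = 1\}$.
   Context: The set of complex polynomials having all zeros in the strip is understood to contain all constant polynomials, including the identically zero polynomial. *)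

theory Defs
  imports Complex_Main "HOL-Computational_Algebra.Polynomial"
begin

definition strip :: "real \<Rightarrow> complex set" where
  "strip b = {z. \<bar>Im z\<bar> \<le> b}"

(* All constant polynomials, the zero polynomial included, belong to this set. *)
definition strip_polys :: "real \<Rightarrow> complex poly set" where
  "strip_polys b = {P. degree P = 0 \<or> (\<forall>z. poly P z = 0 \<longrightarrow> z \<in> strip b)}"

(* pcompose P [:c, 1:] is the polynomial P(x + c). *)
definition fin_diff_op ::
    "int \<Rightarrow> int \<Rightarrow> (int \<Rightarrow> complex) \<Rightarrow> complex \<Rightarrow> complex poly \<Rightarrow> complex poly" where
  "fin_diff_op l m a lam P = (\<Sum>j=l..m. smult (a j) (pcompose P [:- (of_int j * lam), 1:]))"

definition gen_fun :: "int \<Rightarrow> int \<Rightarrow> (int \<Rightarrow> complex) \<Rightarrow> complex \<Rightarrow> complex" where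
  "gen_fun l m a t = (\<Sum>j=l..m. a j * t powi j)"

(* When l < 0 and a l is nonzero, the rational function has a pole at 0. There the
   total function powi returns a junk value (0 powi j = 0 for j < 0), so 0 must not be
   counted as a root in that case. *)
definition gen_roots :: "int \<Rightarrow> int \<Rightarrow> (int \<Rightarrow> complex) \<Rightarrow> complex set" where
  "gen_roots l m a = {t. (t \<noteq> 0 \<or> 0 \<le> l) \<and> gen_fun l m a t = 0}"

lemma poly_fin_diff_op:
  "poly (fin_diff_op l m a lam P) x = (\<Sum>j=l..m. a j * poly P (x - of_int j * lam))"
  by (simp add: fin_diff_op_def poly_sum poly_pcompose algebra_simps)

end

theory Submission
  imports Defs "HOL-Complex_Analysis.Great_Picard"
    "HOL-Computational_Algebra.Fundamental_Theorem_Algebra"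
begin

text \<open>
  If \<open>lam = \<i> c\<close> and the roots of \<open>Q\<close> are unimodular, then up to a shift \<open>T\<close> is a product of
  operators \<open>P(x - \<i> c) - t P(x)\<close> with \<open>|t| = 1\<close>. Each of them moves every horizontal band of zeros
  up by exactly \<open>c / 2\<close>, so that \<open>T\<close> moves it by \<open>c (l + m) / 2\<close>.

  Conversely, let \<open>T\<close> preserve the strip. Rescaled, \<open>T(x\<^sup>n)\<close> at \<open>x = n / v\<close> converges to
  \<open>Q(exp(- lam v))\<close>, so by Hurwitz' theorem \<open>T(x\<^sup>n)\<close> has zeros near \<open>n / v0\<close> for each zero
  \<open>v0 \<noteq> 0\<close> of the limit, and \<open>v0\<close> must be real. As the logarithms of a root of \<open>Q\<close> differ by
  \<open>2 \<pi> \<i>\<close>, this makes \<open>lam\<close> imaginary and the root unimodular. Finally \<open>T((x \<mp> \<i> b)\<^sup>n)\<close> has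
  zeros with imaginary part \<open>\<plusminus> b + c (l + m) / 2\<close>, which forces \<open>l = - m\<close>.
\<close>

section \<open>Bands of zeros\<close>

definition zeros_in_band :: "real \<Rightarrow> real \<Rightarrow> complex poly \<Rightarrow> bool" where
  "zeros_in_band \<alpha> \<beta> P \<longleftrightarrow> degree P = 0 \<or> (\<forall>z. poly P z = 0 \<longrightarrow> \<alpha> \<le> Im z \<and> Im z \<le> \<beta>)"

lemma strip_polys_iff_zeros_in_band: "P \<in> strip_polys b \<longleftrightarrow> zeros_in_band (- b) b P"
  unfolding strip_polys_def zeros_in_band_def strip_def by (auto simp: abs_le_iff)

text \<open>Over the complex numbers \<open>P\<close> splits into linear factors, and each is
  strictly smaller in modulus at \<open>p\<close> than at \<open>q\<close>. Positive degree provides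
  at least one factor, hence strictness.\<close>

lemma norm_poly_less:
  fixes P :: "complex poly"
  assumes "degree P > 0" and closer: "\<And>z. poly P z = 0 \<Longrightarrow> cmod (p - z) < cmod (q - z)"
  shows "cmod (poly P p) < cmod (poly P q)"
proof -
  let ?Z = "{z. poly P z = 0}"
  have "P \<noteq> 0" using assms(1) by auto
  then have fin: "finite ?Z" by (rule poly_roots_finite)
  obtain z0 where z0: "poly P z0 = 0"
    using alg_closed_imp_poly_has_root[OF assms(1)] by blast
  have eq: "cmod (poly P x) = cmod (lead_coeff P) * (\<Prod>z\<in>?Z. cmod (x - z) ^ order z P)" for x
  proof -
    have "poly P x = poly (smult (lead_coeff P) (\<Prod>z\<in>?Z. [:-z, 1:] ^ order z P)) x"
      by (simp only: complex_poly_decompose)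
    then show ?thesis
      by (simp add: poly_prod norm_mult norm_power prod_norm[symmetric])
  qed
  have ord: "order z P > 0" if "z \<in> ?Z" for z
    using that \<open>P \<noteq> 0\<close> order_root by auto
  have "(\<Prod>z\<in>?Z. cmod (p - z) ^ order z P) < (\<Prod>z\<in>?Z. cmod (q - z) ^ order z P)"
  proof (rule prod_mono_strict[of z0])
    show "z0 \<in> ?Z" using z0 by simp
    show "cmod (p - z0) ^ order z0 P < cmod (q - z0) ^ order z0 P"
      using closer[OF z0] ord z0 by (intro power_strict_mono) auto
  next
    fix z assume z: "z \<in> ?Z"
    then have less: "cmod (p - z) < cmod (q - z)" using closer by simp
    show "0 \<le> cmod (p - z) ^ order z P \<and> cmod (p - z) ^ order z P \<le> cmod (q - z) ^ order z P"
      using less by (auto intro!: power_mono)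
    have "0 < cmod (q - z)" using less norm_ge_zero[of "p - z"] by linarith
    then show "0 < cmod (q - z) ^ order z P" by simp
  qed (rule fin)
  then show ?thesis
    unfolding eq using \<open>P \<noteq> 0\<close> by (intro mult_strict_left_mono) auto
qed

text \<open>The squared moduli differ by \<open>4 * c * Im w\<close>.\<close>

lemma cmod_less_shift_ii:
  assumes "c * Im w > 0"
  shows "cmod (w - \<i> * complex_of_real c) < cmod (w + \<i> * complex_of_real c)"
proof -
  have "(Im w - c)\<^sup>2 < (Im w + c)\<^sup>2" using assms by (simp add: power2_eq_square algebra_simps)
  then show ?thesis unfolding cmod_def by (intro real_sqrt_less_mono) simp
qed

lemma norm_poly_shift_less:
  assumes "degree P > 0" and "\<And>z. poly P z = 0 \<Longrightarrow> c * (Im y - Im z) > 0"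
  shows "cmod (poly P (y - \<i> * complex_of_real c)) < cmod (poly P (y + \<i> * complex_of_real c))"
proof (rule norm_poly_less[OF assms(1)])
  fix z assume "poly P z = 0"
  from assms(2)[OF this] have "c * Im (y - z) > 0" by simp
  from cmod_less_shift_ii[OF this]
  show "cmod (y - \<i> * complex_of_real c - z) < cmod (y + \<i> * complex_of_real c - z)"
    by (simp add: algebra_simps)
qed

text \<open>For \<open>y\<close> outside the band all zeros lie strictly on one side of the
  horizontal line through \<open>y\<close>. Replacing \<open>c\<close> by \<open>- c\<close> swaps
  the two points, so one strict inequality serves both sides and both signs of
  \<open>c\<close>.\<close>

lemma norm_poly_shift_neq:
  assumes "degree P > 0" and band: "\<And>z. poly P z = 0 \<Longrightarrow> \<alpha> \<le> Im z \<and> Im z \<le> \<beta>"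
    and "c \<noteq> 0" and out: "\<not> (\<alpha> \<le> Im y \<and> Im y \<le> \<beta>)"
  shows "cmod (poly P (y - \<i> * complex_of_real c)) \<noteq> cmod (poly P (y + \<i> * complex_of_real c))"
proof -
  have "(\<forall>z. poly P z = 0 \<longrightarrow> Im y - Im z > 0) \<or> (\<forall>z. poly P z = 0 \<longrightarrow> Im y - Im z < 0)"
    using out band by force
  then have "(\<forall>z. poly P z = 0 \<longrightarrow> c * (Im y - Im z) > 0) \<or>
             (\<forall>z. poly P z = 0 \<longrightarrow> (- c) * (Im y - Im z) > 0)"
    using \<open>c \<noteq> 0\<close> by (cases "c > 0") (auto simp: zero_less_mult_iff mult_less_0_iff)
  then show ?thesis
    using norm_poly_shift_less[OF assms(1), of c y] norm_poly_shift_less[OF assms(1), of "- c" y]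
    by force
qed

text \<open>With \<open>y = x - \<i> c / 2\<close> the polynomial is \<open>P(y - \<i> c / 2) - t P(y + \<i> c / 2)\<close>, and off the
  band one of the two terms has all its factors strictly larger.\<close>

lemma zeros_in_band_step:
  fixes c :: real and t :: complex
  assumes "zeros_in_band \<alpha> \<beta> P" and "c \<noteq> 0" and "cmod t = 1"
  shows "zeros_in_band (\<alpha> + c / 2) (\<beta> + c / 2)
           (pcompose P [:- (\<i> * complex_of_real c), 1:] - smult t P)"
    (is "zeros_in_band _ _ ?R")
proof (cases "degree P = 0")
  case True
  then have "degree ?R \<le> 0"
    by (intro degree_diff_le) (auto simp: degree_pcompose)
  then show ?thesis by (simp add: zeros_in_band_def)
next
  case False
  then have band: "\<And>z. poly P z = 0 \<Longrightarrow> \<alpha> \<le> Im z \<and> Im z \<le> \<beta>"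
    using assms(1) unfolding zeros_in_band_def by auto
  have "\<alpha> + c / 2 \<le> Im x \<and> Im x \<le> \<beta> + c / 2" if "poly ?R x = 0" for x
  proof (rule ccontr)
    assume out: "\<not> ?thesis"
    define y where "y = x - \<i> * complex_of_real (c / 2)"
    have "\<not> (\<alpha> \<le> Im y \<and> Im y \<le> \<beta>)" using out by (auto simp: y_def)
    then have "cmod (poly P (y - \<i> * complex_of_real (c / 2))) \<noteq>
          cmod (poly P (y + \<i> * complex_of_real (c / 2)))"
      using False band \<open>c \<noteq> 0\<close> by (intro norm_poly_shift_neq) auto
    moreover have "y - \<i> * complex_of_real (c / 2) = x - \<i> * complex_of_real c"
      "y + \<i> * complex_of_real (c / 2) = x" by (auto simp: y_def field_simps)
    moreover have "poly P (x - \<i> * complex_of_real c) = t * poly P x"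
      using that by (simp add: poly_pcompose algebra_simps)
    ultimately show False using \<open>cmod t = 1\<close> by (simp add: norm_mult)
  qed
  then show ?thesis by (simp add: zeros_in_band_def)
qed

section \<open>Factorization of the operator\<close>

text \<open>Summation by parts. With \<open>f i\<close> the \<open>i\<close>-th shift of
  \<open>P\<close>, it says that a factor \<open>[:-t, 1:]\<close> of the generating polynomial acts
  as the operator "shift minus \<open>t\<close>".\<close>

lemma sum_coeff_linear_mult:
  fixes q :: "complex poly" and f :: "nat \<Rightarrow> complex"
  assumes "degree q \<le> N"
  shows "(\<Sum>i\<le>Suc N. coeff ([:-t, 1:] * q) i * f i) = (\<Sum>i\<le>N. coeff q i * (f (Suc i) - t * f i))"
proof -
  have c: "coeff ([:-t, 1:] * q) i = coeff (pCons 0 q) i - t * coeff q i" for i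
    by simp
  have z: "coeff q (Suc N) = 0" using assms by (simp add: coeff_eq_0)
  have "(\<Sum>i\<le>Suc N. coeff ([:-t, 1:] * q) i * f i) =
        (\<Sum>i\<le>Suc N. coeff (pCons 0 q) i * f i) - (\<Sum>i\<le>Suc N. t * coeff q i * f i)"
    unfolding c by (simp add: left_diff_distrib sum_subtractf del: sum.atMost_Suc)
  also have "(\<Sum>i\<le>Suc N. coeff (pCons 0 q) i * f i) = (\<Sum>i\<le>N. coeff q i * f (Suc i))"
    by (subst sum.atMost_Suc_shift) simp
  also have "(\<Sum>i\<le>Suc N. t * coeff q i * f i) = (\<Sum>i\<le>N. t * coeff q i * f i)"
    using z by simp
  finally show ?thesis by (simp add: sum_subtractf[symmetric] algebra_simps)
qed

text \<open>Induction on the degree: splitting off one root \<open>t\<close> of \<open>q\<close>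
  replaces \<open>P\<close> by \<open>P(x - \<i> c) - t P(x)\<close>, whose band lies higher by
  \<open>c / 2\<close>; the cofactor of \<open>q\<close> then acts on that polynomial.\<close>

lemma zeros_in_band_unimodular_roots:
  fixes q :: "complex poly" and c :: real
  assumes "degree q = N" and "q \<noteq> 0" and "\<And>t. poly q t = 0 \<Longrightarrow> cmod t = 1"
    and "c \<noteq> 0" and "zeros_in_band \<alpha> \<beta> P"
  shows "zeros_in_band (\<alpha> + real N * c / 2) (\<beta> + real N * c / 2)
           (\<Sum>i\<le>N. smult (coeff q i) (pcompose P [:- (of_nat i * (\<i> * complex_of_real c)), 1:]))"
  using assms
proof (induction N arbitrary: q P \<alpha> \<beta>)
  case 0
  then show ?case by (cases "coeff q 0 = 0") (auto simp: zeros_in_band_def leading_coeff_0_iff)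
next
  case (Suc N)
  then obtain t where t: "poly q t = 0"
    using alg_closed_imp_poly_has_root[of q] by auto
  then obtain q' where q: "q = [:-t, 1:] * q'"
    unfolding poly_eq_0_iff_dvd by (elim dvdE)
  have "q' \<noteq> 0" using Suc.prems(2) q by auto
  have deg: "degree q' = N"
    using Suc.prems(1) \<open>q' \<noteq> 0\<close> unfolding q by (subst (asm) degree_mult_eq) auto
  have roots: "\<And>s. poly q' s = 0 \<Longrightarrow> cmod s = 1"
    using Suc.prems(3) unfolding q by simp
  have "cmod t = 1" using Suc.prems(3) t by blast
  let ?h = "\<i> * complex_of_real c"
  let ?R = "pcompose P [:- ?h, 1:] - smult t P"
  have "zeros_in_band (\<alpha> + c / 2) (\<beta> + c / 2) ?R"
    by (rule zeros_in_band_step) (use Suc.prems \<open>cmod t = 1\<close> in auto)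
  from Suc.IH[OF deg \<open>q' \<noteq> 0\<close> roots \<open>c \<noteq> 0\<close> this]
  have band: "zeros_in_band (\<alpha> + c / 2 + real N * c / 2) (\<beta> + c / 2 + real N * c / 2)
     (\<Sum>i\<le>N. smult (coeff q' i) (pcompose ?R [:- (of_nat i * ?h), 1:]))"
    by blast
  have "(\<Sum>i\<le>N. smult (coeff q' i) (pcompose ?R [:- (of_nat i * ?h), 1:])) =
        (\<Sum>i\<le>Suc N. smult (coeff q i) (pcompose P [:- (of_nat i * ?h), 1:]))"
  proof (rule poly_eq_poly_eq_iff[THEN iffD1], rule ext)
    fix x
    let ?f = "\<lambda>i::nat. poly P (x - of_nat i * ?h)"
    show "poly (\<Sum>i\<le>N. smult (coeff q' i) (pcompose ?R [:- (of_nat i * ?h), 1:])) x =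
          poly (\<Sum>i\<le>Suc N. smult (coeff q i) (pcompose P [:- (of_nat i * ?h), 1:])) x"
      using sum_coeff_linear_mult[of q' N t ?f] deg
      unfolding q[symmetric]
      by (simp add: poly_sum poly_pcompose algebra_simps del: sum.atMost_Suc)
  qed
  with band show ?case by (simp add: algebra_simps add_divide_distrib)
qed

section \<open>The generating function as a polynomial\<close>

text \<open>This is \<open>Q(t)\<close> divided by \<open>t powi l\<close>. If \<open>a l\<close> is
  nonzero, so is its constant coefficient, and its roots are exactly the nonzero roots of
  \<open>Q\<close>.\<close>

definition gen_poly :: "int \<Rightarrow> int \<Rightarrow> (int \<Rightarrow> complex) \<Rightarrow> complex poly" where
  "gen_poly l m a = (\<Sum>i\<le>nat (m - l). monom (a (l + int i)) i)"

lemma coeff_gen_poly: "coeff (gen_poly l m a) i = (if i \<le> nat (m - l) then a (l + int i) else 0)"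
  by (simp add: gen_poly_def coeff_sum)

lemma degree_gen_poly:
  assumes "l < m" "a m \<noteq> 0"
  shows "degree (gen_poly l m a) = nat (m - l)"
proof (rule antisym)
  show "degree (gen_poly l m a) \<le> nat (m - l)"
    by (rule degree_le) (simp add: coeff_gen_poly)
  show "nat (m - l) \<le> degree (gen_poly l m a)"
    by (rule le_degree) (use assms in \<open>simp add: coeff_gen_poly\<close>)
qed

lemma sum_int_interval_eq_sum_nat:
  assumes "l \<le> m"
  shows "(\<Sum>j=l..m. f j) = (\<Sum>i\<le>nat (m - l). f (l + int i))"
  by (rule sum.reindex_bij_witness[of _ "\<lambda>i. l + int i" "\<lambda>j. nat (j - l)"]) (use assms in auto)

lemma gen_fun_eq_gen_poly:
  assumes "l < m" "t \<noteq> 0"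
  shows "gen_fun l m a t = t powi l * poly (gen_poly l m a) t"
  unfolding gen_fun_def gen_poly_def using assms
  by (subst sum_int_interval_eq_sum_nat)
     (auto simp: poly_sum poly_monom sum_distrib_left power_int_add intro!: sum.cong)

lemma poly_gen_poly_0:
  assumes "l < m" "a l \<noteq> 0"
  shows "poly (gen_poly l m a) 0 \<noteq> 0"
  using assms by (simp add: poly_0_coeff_0 coeff_gen_poly)

text \<open>The operator is the one of \<open>gen_poly\<close> followed by a translation by
  \<open>l * lam\<close>. The translation contributes \<open>l * c\<close> and the
  \<open>m - l\<close> roots contribute \<open>(m - l) * c / 2\<close>, which add up to
  \<open>s\<close>.\<close>

lemma zeros_in_band_fin_diff_op:
  fixes c :: real
  assumes "l < m" "a l \<noteq> 0" "a m \<noteq> 0" "c \<noteq> 0"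
    and roots: "\<And>t. t \<noteq> 0 \<Longrightarrow> gen_fun l m a t = 0 \<Longrightarrow> cmod t = 1"
    and "zeros_in_band \<alpha> \<beta> P"
  defines "s \<equiv> c * of_int (l + m) / 2"
  shows "zeros_in_band (\<alpha> + s) (\<beta> + s) (fin_diff_op l m a (\<i> * complex_of_real c) P)"
proof -
  let ?q = "gen_poly l m a" and ?N = "nat (m - l)" and ?h = "\<i> * complex_of_real c"
  let ?G = "\<Sum>i\<le>?N. smult (coeff ?q i) (pcompose P [:- (of_nat i * ?h), 1:])"
  have q0: "poly ?q 0 \<noteq> 0" using assms(1,2) by (rule poly_gen_poly_0)
  have "cmod t = 1" if "poly ?q t = 0" for t
    using that roots gen_fun_eq_gen_poly[OF \<open>l < m\<close>, of t a] q0 by (cases "t = 0") auto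
  moreover have "?q \<noteq> 0" using q0 by auto
  ultimately have band: "zeros_in_band (\<alpha> + real ?N * c / 2) (\<beta> + real ?N * c / 2) ?G"
    using degree_gen_poly[of l m a] assms by (intro zeros_in_band_unimodular_roots) auto
  have eq: "fin_diff_op l m a ?h P = pcompose ?G [:- (of_int l * ?h), 1:]"
  proof (rule poly_eq_poly_eq_iff[THEN iffD1], rule ext)
    fix x
    show "poly (fin_diff_op l m a ?h P) x = poly (pcompose ?G [:- (of_int l * ?h), 1:]) x"
      unfolding poly_fin_diff_op using \<open>l < m\<close>
      by (subst sum_int_interval_eq_sum_nat)
         (auto simp: poly_sum poly_pcompose coeff_gen_poly algebra_simps intro!: sum.cong)
  qed
  have s: "s = real ?N * c / 2 + of_int l * c"
    using \<open>l < m\<close> by (simp add: s_def field_simps)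
  show ?thesis
  proof (cases "degree ?G = 0")
    case True
    then show ?thesis unfolding eq by (simp add: zeros_in_band_def degree_pcompose)
  next
    case False
    have "\<alpha> + s \<le> Im x \<and> Im x \<le> \<beta> + s" if "poly (fin_diff_op l m a ?h P) x = 0" for x
    proof -
      have "poly ?G (x - of_int l * ?h) = 0"
        using that unfolding eq by (simp add: poly_pcompose algebra_simps)
      then have "\<alpha> + real ?N * c / 2 \<le> Im (x - of_int l * ?h) \<and>
                 Im (x - of_int l * ?h) \<le> \<beta> + real ?N * c / 2"
        using band False unfolding zeros_in_band_def by blast
      then show ?thesis by (simp add: s)
    qed
    then show ?thesis by (simp add: zeros_in_band_def)
  qed
qed

section \<open>Zeros of the operator on powers\<close>

text \<open>With \<open>u = w / n\<close>, both \<open>1 + u\<close> and \<open>exp u\<close> have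
  modulus at most \<open>M = exp (cmod u)\<close>. Divided by \<open>M\<close> they lie in the unit
  disc, where \<open>n\<close>-th powers differ by at most \<open>n\<close> times the difference of
  the bases; \<open>M ^ n\<close> is \<open>exp (cmod w)\<close>.\<close>

lemma norm_exp_limit_diff_le:
  fixes w :: complex
  assumes "n > 0"
  shows "cmod ((1 + w / of_nat n) ^ n - exp w) \<le> (cmod w)\<^sup>2 * exp (cmod w) / real n"
proof -
  define u where "u = w / of_nat n"
  define M where "M = exp (cmod u)"
  have M: "M > 0" "M \<ge> 1" by (auto simp: M_def)
  have nu: "real n * cmod u = cmod w" using assms by (simp add: u_def norm_divide)
  have Mn: "M ^ n = exp (cmod w)" by (simp add: M_def exp_of_nat_mult[symmetric] nu)
  have "cmod (1 + u) \<le> 1 + cmod u" using norm_triangle_ineq[of 1 u] by simp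
  also have "\<dots> \<le> M" unfolding M_def by (rule exp_ge_add_one_self)
  finally have 1: "cmod ((1 + u) / of_real M) \<le> 1" using M by (simp add: norm_divide)
  have 2: "cmod (exp u / of_real M) \<le> 1"
    using norm_exp[of u] M by (simp add: norm_divide M_def)
  have "cmod (exp u - (\<Sum>k\<le>1. u ^ k / fact k)) \<le> exp \<bar>Re u\<bar> * cmod u ^ Suc 1 / fact 1"
    by (rule Taylor_exp)
  also have "\<dots> \<le> M * (cmod u)\<^sup>2"
    using abs_Re_le_cmod[of u] by (simp add: M_def power2_eq_square mult_right_mono)
  finally have 3: "cmod (1 + u - exp u) \<le> M * (cmod u)\<^sup>2"
    by (simp add: norm_minus_commute)
  have "cmod (((1 + u) / of_real M) ^ n - (exp u / of_real M) ^ n)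
         \<le> real n * cmod ((1 + u) / of_real M - exp u / of_real M)"
    using norm_power_diff[OF 1 2] .
  also have "((1 + u) / of_real M) ^ n - (exp u / of_real M) ^ n =
             ((1 + u) ^ n - exp w) / of_real (M ^ n)"
    using assms by (simp add: power_divide diff_divide_distrib exp_of_nat_mult[symmetric] u_def)
  also have "(1 + u) / of_real M - exp u / of_real M = (1 + u - exp u) / of_real M"
    by (simp add: diff_divide_distrib)
  also have "cmod ((1 + u - exp u) / of_real M) \<le> (cmod u)\<^sup>2"
    using 3 M by (simp add: norm_divide field_simps)
  finally have "cmod (((1 + u) ^ n - exp w) / of_real (M ^ n)) \<le> real n * (cmod u)\<^sup>2"
    by (simp add: mult_left_mono)
  then have "cmod ((1 + u) ^ n - exp w) \<le> real n * (cmod u)\<^sup>2 * exp (cmod w)"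
    by (simp add: norm_divide Mn field_simps)
  also have "real n * (cmod u)\<^sup>2 = (cmod w)\<^sup>2 / real n"
    using assms by (simp add: u_def norm_divide power_divide power2_eq_square)
  finally show ?thesis by (simp add: u_def)
qed

lemma uniform_limit_power_sum_exp_sum:
  fixes a :: "int \<Rightarrow> complex"
  assumes "bounded K"
  shows "uniform_limit K (\<lambda>n v. \<Sum>j=l..m. a j * (1 - of_int j * lam * v / of_nat n) ^ n)
           (\<lambda>v. \<Sum>j=l..m. a j * exp (- (of_int j * lam * v))) sequentially"
proof (rule uniform_limitI)
  fix e :: real assume "e > 0"
  from assms obtain R where R: "R > 0" "\<And>v. v \<in> K \<Longrightarrow> cmod v \<le> R"
    unfolding bounded_pos by blast
  \<comment> \<open>A bound for the modulus of \<open>of_int j * lam * v\<close> on all of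
    \<open>K\<close>, making the error \<open>C / n\<close> independent of \<open>v\<close>.\<close>
  define W where "W j = real_of_int \<bar>j\<bar> * cmod lam * R" for j
  define C where "C = (\<Sum>j=l..m. cmod (a j) * ((W j)\<^sup>2 * exp (W j)))"
  have bound: "dist (\<Sum>j=l..m. a j * (1 - of_int j * lam * v / of_nat n) ^ n)
              (\<Sum>j=l..m. a j * exp (- (of_int j * lam * v))) \<le> C / real n"
    if "v \<in> K" "n > 0" for v n
  proof -
    have "cmod (a j * ((1 - of_int j * lam * v / of_nat n) ^ n - exp (- (of_int j * lam * v))))
            \<le> cmod (a j) * ((W j)\<^sup>2 * exp (W j)) / real n" for j
    proof -
      let ?w = "- (of_int j * lam * v)"
      have "cmod ?w \<le> W j"
        using R(2)[OF that(1)] by (simp add: W_def norm_mult mult_left_mono)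
      then have "(cmod ?w)\<^sup>2 * exp (cmod ?w) \<le> (W j)\<^sup>2 * exp (W j)"
        by (intro mult_mono power_mono) auto
      then have "(cmod ?w)\<^sup>2 * exp (cmod ?w) / real n \<le> (W j)\<^sup>2 * exp (W j) / real n"
        by (rule divide_right_mono) simp
      with norm_exp_limit_diff_le[OF that(2), of ?w]
      have "cmod ((1 + ?w / of_nat n) ^ n - exp ?w) \<le> (W j)\<^sup>2 * exp (W j) / real n"
        by (rule order_trans)
      then show ?thesis
        using mult_left_mono[of _ _ "cmod (a j)"] by (fastforce simp: norm_mult)
    qed
    then show ?thesis
      unfolding dist_norm sum_subtractf[symmetric] right_diff_distrib[symmetric] C_def
        sum_divide_distrib
      by (intro sum_norm_le) auto
  qed
  obtain N where N: "C / e < real N" using reals_Archimedean2 by blast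
  have "\<forall>v\<in>K. dist (\<Sum>j=l..m. a j * (1 - of_int j * lam * v / of_nat n) ^ n)
              (\<Sum>j=l..m. a j * exp (- (of_int j * lam * v))) < e" if "n \<ge> max N 1" for n
  proof
    fix v assume "v \<in> K"
    have "n > 0" using that by simp
    have "C / e < real n" using N that by simp
    then have "C / real n < e" using \<open>n > 0\<close> \<open>e > 0\<close> by (simp add: field_simps)
    with bound[OF \<open>v \<in> K\<close> \<open>n > 0\<close>]
    show "dist (\<Sum>j=l..m. a j * (1 - of_int j * lam * v / of_nat n) ^ n)
              (\<Sum>j=l..m. a j * exp (- (of_int j * lam * v))) < e" by (rule le_less_trans)
  qed
  then show "\<forall>\<^sub>F n in sequentially. \<forall>v\<in>K.
      dist (\<Sum>j=l..m. a j * (1 - of_int j * lam * v / of_nat n) ^ n)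
           (\<Sum>j=l..m. a j * exp (- (of_int j * lam * v))) < e"
    unfolding eventually_sequentially by blast
qed

lemma gen_fun_exp: "gen_fun l m a (exp u) = (\<Sum>j=l..m. a j * exp (of_int j * u))"
  by (simp add: gen_fun_def exp_power_int)

text \<open>\<open>Q\<close> has only finitely many nonzero roots, while
  \<open>exp (- (lam * v))\<close> takes infinitely many values on the ball. This gives the
  nonconstancy needed for Hurwitz' theorem.\<close>

lemma gen_fun_exp_nonzero_near:
  assumes "l < m" "a l \<noteq> 0" "lam \<noteq> 0" "r > 0"
  shows "\<exists>v\<in>ball v0 r. gen_fun l m a (exp (- (lam * v))) \<noteq> 0"
proof (rule ccontr)
  assume zero: "\<not> ?thesis"
  \<comment> \<open>The values along the segment \<open>v0 + s / lam\<close>; their moduli are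
    proportional to \<open>exp (- s)\<close>, so they are distinct.\<close>
  define \<phi> where "\<phi> s = exp (- (lam * v0)) * exp (- complex_of_real s)" for s
  let ?I = "{0<..<r * cmod lam}"
  have "poly (gen_poly l m a) (\<phi> s) = 0" if "s \<in> ?I" for s
  proof -
    let ?v = "v0 + complex_of_real s / lam"
    have "?v \<in> ball v0 r"
      using that assms by (simp add: dist_norm norm_divide field_simps)
    moreover have "exp (- (lam * ?v)) = \<phi> s"
      using assms by (simp add: \<phi>_def exp_add[symmetric] algebra_simps)
    ultimately have "gen_fun l m a (\<phi> s) = 0" using zero by metis
    then show ?thesis
      using gen_fun_eq_gen_poly[OF assms(1), of "\<phi> s" a] by (auto simp: \<phi>_def)
  qed
  then have "\<phi> ` ?I \<subseteq> {t. poly (gen_poly l m a) t = 0}" by auto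
  moreover have "gen_poly l m a \<noteq> 0" using poly_gen_poly_0[of l m a] assms by auto
  ultimately have "finite (\<phi> ` ?I)"
    using poly_roots_finite finite_subset by blast
  moreover have "inj_on \<phi> ?I"
  proof (rule inj_onI)
    fix s t assume "\<phi> s = \<phi> t"
    then have "cmod (exp (- complex_of_real s)) = cmod (exp (- complex_of_real t))"
      by (simp add: \<phi>_def)
    then show "s = t" by simp
  qed
  ultimately have "finite ?I" by (rule finite_imageD)
  moreover have "0 < r * cmod lam" using assms by simp
  ultimately show False using infinite_Ioo by blast
qed

lemma ex_nonzero_gen_fun_root:
  assumes "l < m" "a l \<noteq> 0" "a m \<noteq> 0"
  obtains t where "t \<noteq> 0" "gen_fun l m a t = 0"
proof -
  have "degree (gen_poly l m a) > 0" using assms by (simp add: degree_gen_poly)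
  then obtain t where t: "poly (gen_poly l m a) t = 0"
    using alg_closed_imp_poly_has_root by blast
  then have "t \<noteq> 0" using poly_gen_poly_0[of l m a] assms by auto
  with t that show ?thesis using gen_fun_eq_gen_poly[OF assms(1)] by auto
qed

text \<open>Without such zeros for large \<open>n\<close>, Hurwitz' theorem would make the limit
  zero-free at \<open>v0\<close>. The bound \<open>r \<le> cmod v0\<close> keeps 0 out of the ball,
  so \<open>n / v\<close> makes sense; the witness \<open>y\<close> certifies that the image of the
  power is not the zero polynomial.\<close>

lemma shifted_power_sum_zero:
  fixes v0 :: complex
  assumes "l < m" "a l \<noteq> 0" "lam \<noteq> 0" "0 < r" "r \<le> cmod v0"
    and root: "gen_fun l m a (exp (- (lam * v0))) = 0"
  shows "\<exists>n\<ge>N. \<exists>v\<in>ball v0 r. v \<noteq> 0 \<and> (\<Sum>j=l..m. a j * (of_nat n / v - of_int j * lam) ^ n) = 0 \<and>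
           (\<exists>y. (\<Sum>j=l..m. a j * (y - of_int j * lam) ^ n) \<noteq> 0)"
proof (rule ccontr)
  assume contr: "\<not> ?thesis"
  let ?S = "ball v0 r"
  define f where "f n v = (\<Sum>j=l..m. a j * (1 - of_int j * lam * v / of_nat n) ^ n)" for n v
  define g where "g v = (\<Sum>j=l..m. a j * exp (- (of_int j * lam * v)))" for v
  have g: "g v = gen_fun l m a (exp (- (lam * v)))" for v
    by (simp add: g_def gen_fun_exp mult.assoc)
  have ul: "uniform_limit K f g sequentially" if "bounded K" for K
    unfolding f_def [abs_def] g_def [abs_def] using that by (rule uniform_limit_power_sum_exp_sum)
  have nz: "v \<noteq> 0" if "v \<in> ?S" for v
    using that \<open>r \<le> cmod v0\<close> by (auto simp: dist_norm)
  have scale: "(\<Sum>j=l..m. a j * (of_nat n / v - of_int j * lam) ^ n) = (of_nat n / v) ^ n * f n v"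
    if "n > 0" "v \<noteq> 0" for n v
  proof -
    have "of_nat n / v - of_int j * lam = of_nat n / v * (1 - of_int j * lam * v / of_nat n)" for j
      using that by (simp add: field_simps)
    then show ?thesis
      by (simp only: power_mult_distrib f_def sum_distrib_left) (simp add: mult_ac)
  qed
  \<comment> \<open>\<open>v1\<close> serves twice: it shows that \<open>g\<close> is not constant,
    and it yields the witness \<open>y\<close> for large \<open>n\<close>.\<close>
  obtain v1 where v1: "v1 \<in> ?S" "g v1 \<noteq> 0"
    using gen_fun_exp_nonzero_near[where a = a, OF assms(1-4)] unfolding g by blast
  have "(\<lambda>n. f n v1) \<longlonglongrightarrow> g v1"
    using tendsto_uniform_limitI[OF ul[of "{v1}"]] by simp
  then have "\<forall>\<^sub>F n in sequentially. f n v1 \<noteq> 0"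
    using v1(2) by (rule tendsto_imp_eventually_ne)
  then obtain M where M: "\<And>n. n \<ge> M \<Longrightarrow> f n v1 \<noteq> 0"
    unfolding eventually_sequentially by blast
  \<comment> \<open>Starting the sequence at \<open>L\<close> ensures \<open>n \<ge> N\<close>, a
    nonzero value at \<open>v1\<close>, and a nonzero denominator.\<close>
  define L where "L = max (max M N) 1"
  have L: "M \<le> L" "N \<le> L" and of_nat_L: "complex_of_nat (n + L) \<noteq> 0" for n
    unfolding L_def of_nat_eq_0_iff by linarith+
  have zero_free: "f (n + L) v \<noteq> 0" if "v \<in> ?S" for n v
  proof
    assume f0: "f (n + L) v = 0"
    have pos: "n + L > 0" unfolding L_def by linarith
    have "(\<Sum>j=l..m. a j * (of_nat (n + L) / v1 - of_int j * lam) ^ (n + L)) \<noteq> 0"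
      using scale[OF pos nz[OF v1(1)]] M[of "n + L"] nz[OF v1(1)] of_nat_L[of n] L
      by (simp del: of_nat_add)
    moreover have "(\<Sum>j=l..m. a j * (of_nat (n + L) / v - of_int j * lam) ^ (n + L)) = 0"
      using scale[OF pos nz[OF that]] f0 by simp
    moreover have "n + L \<ge> N" using L by simp
    ultimately show False using contr that nz[OF that] by blast
  qed
  have "g v0 \<noteq> 0"
  proof (rule Hurwitz_no_zeros[of ?S "\<lambda>n. f (n + L)" g])
    show "f (n + L) holomorphic_on ?S" for n
      unfolding f_def by (intro holomorphic_intros of_nat_L)
    show "g holomorphic_on ?S"
      unfolding g_def by (intro holomorphic_intros)
    show "uniform_limit K (\<lambda>n. f (n + L)) g sequentially" if "compact K" for K
      using filterlim_compose[OF ul[OF compact_imp_bounded[OF that]]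
          filterlim_add_const_nat_at_top[of L]] .
    show "\<not> g constant_on ?S"
    proof
      assume "g constant_on ?S"
      then have "g v1 = g v0"
        using v1(1) \<open>0 < r\<close> unfolding constant_on_def by (metis centre_in_ball)
      then show False using v1(2) root by (simp add: g)
    qed
  qed (use zero_free \<open>0 < r\<close> in auto)
  then show False using root by (simp add: g)
qed

section \<open>Consequences of preserving the strip\<close>

lemma poly_fin_diff_op_power:
  "poly (fin_diff_op l m a lam ([:- z, 1:] ^ n)) x = (\<Sum>j=l..m. a j * (x - z - of_int j * lam) ^ n)"
  by (simp add: poly_fin_diff_op algebra_simps)

lemma linear_power_in_strip_polys:
  assumes "\<bar>Im z\<bar> \<le> b"
  shows "[:- z, 1:] ^ n \<in> strip_polys b"
  using assms by (auto simp: strip_polys_def strip_def)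

text \<open>\<open>T\<close> commutes with translations, so a zero \<open>y\<close> for
  \<open>x ^ n\<close> becomes \<open>y + z\<close> for \<open>(x - z) ^ n\<close>. The value at
  \<open>y'\<close> rules out a constant image, which would belong to the set wherever it
  vanishes.\<close>

lemma power_sum_zero_in_strip:
  assumes sub: "fin_diff_op l m a lam ` strip_polys b \<subseteq> strip_polys b" and "\<bar>Im z\<bar> \<le> b"
    and zero: "(\<Sum>j=l..m. a j * (y - of_int j * lam) ^ n) = 0"
    and nonzero: "(\<Sum>j=l..m. a j * (y' - of_int j * lam) ^ n) \<noteq> 0"
  shows "\<bar>Im (y + z)\<bar> \<le> b"
proof -
  let ?R = "fin_diff_op l m a lam ([:- z, 1:] ^ n)"
  have R: "?R \<in> strip_polys b"
    using sub linear_power_in_strip_polys[OF assms(2)] by blast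
  have p0: "poly ?R (y + z) = 0" using zero by (simp add: poly_fin_diff_op_power)
  have "poly ?R (y' + z) \<noteq> 0" using nonzero by (simp add: poly_fin_diff_op_power)
  with p0 have "degree ?R \<noteq> 0" by (metis degree_eq_zeroE poly_const_conv)
  then show ?thesis using R p0 by (auto simp: strip_polys_def strip_def)
qed

text \<open>The zeros \<open>n / v\<close> escape to infinity along the direction of \<open>1 / v0\<close>, which must be real.\<close>

lemma strip_preserving_imp_real:
  assumes sub: "fin_diff_op l m a lam ` strip_polys b \<subseteq> strip_polys b" and "b > 0"
    and "l < m" "a l \<noteq> 0" "lam \<noteq> 0"
    and root: "gen_fun l m a (exp (- (lam * v0))) = 0"
  shows "Im v0 = 0"
proof (rule ccontr)
  assume im: "Im v0 \<noteq> 0"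
  \<comment> \<open>On the ball of this radius \<open>\<bar>Im v\<bar>\<close> stays above
    \<open>r\<close>, and \<open>\<delta>\<close> below bounds \<open>\<bar>Im (1 / v)\<bar>\<close>
    from below.\<close>
  define r where "r = \<bar>Im v0\<bar> / 2"
  have r: "0 < r" "r \<le> cmod v0"
    using im abs_Im_le_cmod[of v0] by (auto simp: r_def)
  define \<delta> where "\<delta> = r / (cmod v0 + r)\<^sup>2"
  have \<delta>: "\<delta> > 0" using r by (simp add: \<delta>_def)
  obtain N where N: "b / \<delta> < real N" using reals_Archimedean2 by blast
  obtain n v y' where n: "n \<ge> N" and v: "v \<in> ball v0 r" "v \<noteq> 0"
    and zero: "(\<Sum>j=l..m. a j * (of_nat n / v - of_int j * lam) ^ n) = 0"
    and nonzero: "(\<Sum>j=l..m. a j * (y' - of_int j * lam) ^ n) \<noteq> 0"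
    using shifted_power_sum_zero[where N = N and a = a, OF assms(3-5) r root] by blast
  have "\<bar>Im (of_nat n / v)\<bar> \<le> b"
    using power_sum_zero_in_strip[OF sub _ zero nonzero, of 0] \<open>b > 0\<close> by simp
  moreover have "\<bar>Im (of_nat n / v)\<bar> = real n * (\<bar>Im v\<bar> / (cmod v)\<^sup>2)"
    by (simp add: Im_divide cmod_power2 abs_mult)
  moreover have "\<delta> \<le> \<bar>Im v\<bar> / (cmod v)\<^sup>2"
  proof -
    have d: "cmod (v0 - v) < r" using v by (simp add: dist_norm)
    have "\<bar>Im v0 - Im v\<bar> < r" using d abs_Im_le_cmod[of "v0 - v"] by simp
    then have "r \<le> \<bar>Im v\<bar>" unfolding r_def by linarith
    moreover have "cmod v \<le> cmod v0 + r"
      using d norm_triangle_ineq2[of v v0] by (simp add: norm_minus_commute)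
    ultimately show ?thesis
      unfolding \<delta>_def using v r by (intro frac_le power_mono) auto
  qed
  ultimately have "real n * \<delta> \<le> b"
    by (metis mult_left_mono of_nat_0_le_iff order_trans)
  moreover have "b < real N * \<delta>" using N \<delta> by (simp add: field_simps)
  moreover have "real N * \<delta> \<le> real n * \<delta>" using n \<delta> by (intro mult_right_mono) auto
  ultimately show False by linarith
qed

text \<open>Each logarithm \<open>u\<close> of \<open>t\<close> gives a zero
  \<open>- u / lam\<close> of the limit function, which must be real. So all logarithms of
  \<open>t\<close> are real multiples of \<open>lam\<close>.\<close>

lemma strip_preserving_imp_imaginary:
  assumes sub: "fin_diff_op l m a lam ` strip_polys b \<subseteq> strip_polys b" and "b > 0"
    and "l < m" "a l \<noteq> 0" "lam \<noteq> 0" and "t \<noteq> 0" "gen_fun l m a t = 0"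
  shows "Re lam = 0 \<and> cmod t = 1"
proof -
  have real: "\<exists>s. u = - lam * complex_of_real s" if "exp u = t" for u
  proof
    let ?v = "- u / lam"
    have "gen_fun l m a (exp (- (lam * ?v))) = 0" using that assms by simp
    from strip_preserving_imp_real[OF assms(1-5) this]
    have "?v = complex_of_real (Re ?v)" by (simp add: complex_eq_iff)
    then show "u = - lam * complex_of_real (Re ?v)"
      using \<open>lam \<noteq> 0\<close> by (metis mult_minus_left mult_minus_right nonzero_mult_div_cancel_left
          times_divide_eq_right minus_minus)
  qed
  \<comment> \<open>The logarithms of \<open>t\<close> differ by \<open>2 \<pi> \<i>\<close>, so \<open>lam\<close> has the direction of \<open>\<i>\<close>.\<close>
  obtain s1 where s1: "Ln t = - lam * complex_of_real s1"
    using real[of "Ln t"] \<open>t \<noteq> 0\<close> by auto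
  obtain s2 where s2: "Ln t + 2 * of_real pi * \<i> = - lam * complex_of_real s2"
    using real[of "Ln t + 2 * of_real pi * \<i>"] \<open>t \<noteq> 0\<close> by (auto simp: exp_add)
  have "2 * of_real pi * \<i> = lam * complex_of_real (s1 - s2)"
    using s1 s2 by (simp add: algebra_simps)
  then have "Re lam * (s1 - s2) = 0" "Im lam * (s1 - s2) = 2 * pi"
    by (auto simp: complex_eq_iff)
  then have re: "Re lam = 0" by auto
  then have "Re (Ln t) = 0" using s1 by simp
  then have "cmod (exp (Ln t)) = 1" by (simp only: norm_exp_eq_Re) simp
  then show ?thesis using re \<open>t \<noteq> 0\<close> by simp
qed

theorem theorem1p2:
  fixes b :: real and l m :: int and a :: "int \<Rightarrow> complex" and lam :: complex
  assumes "b > 0" and "l < m" and "a l \<noteq> 0" and "a m \<noteq> 0" and "lam \<noteq> 0"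
  shows "fin_diff_op l m a lam ` strip_polys b \<subseteq> strip_polys b \<longleftrightarrow>
         Re lam = 0 \<and> l = - m \<and> (\<forall>t \<in> gen_roots l m a. cmod t = 1)"
proof
  assume cond: "Re lam = 0 \<and> l = - m \<and> (\<forall>t \<in> gen_roots l m a. cmod t = 1)"
  define c where "c = Im lam"
  have lam: "lam = \<i> * complex_of_real c" using cond by (simp add: c_def complex_eq_iff)
  have "c \<noteq> 0" using lam \<open>lam \<noteq> 0\<close> by auto
  have roots: "cmod t = 1" if "t \<noteq> 0" "gen_fun l m a t = 0" for t
    using cond that by (simp add: gen_roots_def)
  have "fin_diff_op l m a lam P \<in> strip_polys b" if "P \<in> strip_polys b" for P
    \<comment> \<open>For \<open>l = - m\<close> the displacement of the band is zero.\<close>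
    using zeros_in_band_fin_diff_op[of l m a c "- b" b P] assms \<open>c \<noteq> 0\<close> roots that cond
    by (simp add: strip_polys_iff_zeros_in_band lam)
  then show "fin_diff_op l m a lam ` strip_polys b \<subseteq> strip_polys b" by blast
next
  assume sub: "fin_diff_op l m a lam ` strip_polys b \<subseteq> strip_polys b"
  note imag = strip_preserving_imp_imaginary[OF sub assms(1-3,5)]
  obtain t0 where t0: "t0 \<noteq> 0" "gen_fun l m a t0 = 0"
    using ex_nonzero_gen_fun_root[where a = a, OF assms(2-4)] by blast
  have re: "Re lam = 0" using imag[OF t0] by simp
  define c where "c = Im lam"
  have lam: "lam = \<i> * complex_of_real c" using re by (simp add: c_def complex_eq_iff)
  have "c \<noteq> 0" using lam \<open>lam \<noteq> 0\<close> by auto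
  \<comment> \<open>\<open>Ln t0\<close> itself vanishes for \<open>t0 = 1\<close>. The next
    logarithm has positive imaginary part, so \<open>v0\<close> is nonzero.\<close>
  define u where "u = Ln t0 + 2 * of_real pi * \<i>"
  have "exp u = t0" using t0 by (simp add: u_def exp_add)
  have "Im u = Im (Ln t0) + 2 * pi" by (simp add: u_def)
  then have "Im u > 0" using mpi_less_Im_Ln[OF t0(1)] pi_gt_zero by linarith
  define v0 where "v0 = - u / lam"
  have "v0 \<noteq> 0" using \<open>Im u > 0\<close> \<open>lam \<noteq> 0\<close> by (auto simp: v0_def)
  have "gen_fun l m a (exp (- (lam * v0))) = 0"
    using \<open>lam \<noteq> 0\<close> \<open>exp u = t0\<close> t0 by (simp add: v0_def)
  with shifted_power_sum_zero[of l m a lam "cmod v0" v0 0] assms \<open>v0 \<noteq> 0\<close>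
  obtain n y y' where zero: "(\<Sum>j=l..m. a j * (y - of_int j * lam) ^ n) = 0"
    and nonzero: "(\<Sum>j=l..m. a j * (y' - of_int j * lam) ^ n) \<noteq> 0"
    by auto
  \<comment> \<open>Powers centred at the two edge points of the strip: \<open>y\<close> can be
    moved neither up nor down.\<close>
  have "\<bar>Im (y + \<i> * complex_of_real b)\<bar> \<le> b" "\<bar>Im (y + - \<i> * complex_of_real b)\<bar> \<le> b"
    using \<open>b > 0\<close> by (intro power_sum_zero_in_strip[OF sub _ zero nonzero]; simp)+
  then have im: "Im y = 0" by simp
  let ?P = "[:- 0, 1:] ^ n :: complex poly"
  let ?R = "fin_diff_op l m a lam ?P"
  have "zeros_in_band 0 0 ?P" by (auto simp: zeros_in_band_def)
  \<comment> \<open>The roots are already known to be unimodular, so the band result applies to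
    \<open>x ^ n\<close> with a band of width zero and locates the zeros exactly.\<close>
  from zeros_in_band_fin_diff_op[where a = a, OF assms(2-4) \<open>c \<noteq> 0\<close> _ this] imag
  have band: "zeros_in_band (c * of_int (l + m) / 2) (c * of_int (l + m) / 2) ?R"
    unfolding lam[symmetric] by simp
  have p0: "poly ?R y = 0" using zero unfolding poly_fin_diff_op_power by simp
  have "poly ?R y' \<noteq> 0" using nonzero unfolding poly_fin_diff_op_power by simp
  with p0 have "degree ?R \<noteq> 0" by (metis degree_eq_zeroE poly_const_conv)
  then have "c * of_int (l + m) / 2 = Im y"
    using band p0 unfolding zeros_in_band_def by force
  then have "real_of_int (l + m) = 0" using im \<open>c \<noteq> 0\<close> by simp
  then have lm: "l = - m" by linarith
  \<comment> \<open>Here \<open>l < 0\<close>, so 0 does not count as a root.\<close>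
  then have "\<forall>t \<in> gen_roots l m a. cmod t = 1"
    using imag \<open>l < m\<close> by (auto simp: gen_roots_def)
  with re lm show "Re lam = 0 \<and> l = - m \<and> (\<forall>t \<in> gen_roots l m a. cmod t = 1)" by blast
qed

end
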